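(* Let $A$ be a finite alphabet with $|A|>1$ and let $\rho\in\mathrm{CRC}(A^{-\omega})$ be a closed right congruence. Then: (i) $\underline{\rho}=\tau_{\mathrm{Res}(\rho)}$; (ii) $\overline{\rho}=\tau_{A^*\Lambda_{\rho}}=\tau_{A^*\Lambda'_{\rho}}$.
   Context: $A^{-\omega}$ is the set of left infinite words $\cdots a_3a_2a_1$ ($a_i\in A$); for $x\in A^{-\omega}$ and $u\in A^*$, $xu$ is the concatenation. The suffix metric is $d(x,y)=2^{-|\mathrm{lcs}(x,y)|}$ for $x\ne y$, where $\mathrm{lcs}(x,y)$ is the longest common suffix, and $d(x,x)=0$; $A^{-\omega}\times A^{-\omega}$ carries the product (max) metric. A right congruence on $A^{-\omega}$ is an equivalence relation $\rho$ such that $(x,y)\in\rho$ implies $(xu,yu)\in\rho$ for all $u\in A^*$. $\mathrm{RC}(A^{-\omega})$ is the lattice (under inclusion) of right congruences; $\mathrm{CRC}(A^{-\omega})$ is the set of those that are closed subsets of $A^{-\omega}\times A^{-\omega}$. For $P\subseteq A^*$: $x\,\tau_P\,y$ iff $x=y$ or $x,y\in A^{-\omega}u$ for some $u\in P$. An ideal of $A^*$ is a subset $I$ with $A^*IA^*\subseteq I$ (the empty set is allowed). $\rho\in\mathrm{RC}(A^{-\omega})$ is a special right congruence if $\rho=\tau_I$ for some ideal $I$ of $A^*$; $\mathrm{SRC}(A^{-\omega})$ is the set of these. $\underline{\rho}=\bigvee\{\tau\in\mathrm{SRC}(A^{-\omega})\mid\tau\subseteq\rho\}$ and $\overline{\rho}=\bigwedge\{\tau\in\mathrm{SRC}(A^{-\omega})\mid\tau\supseteq\rho\}$,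 join and meet being taken in $\mathrm{RC}(A^{-\omega})$. The Cayley graph $\mathrm{Cay}(\rho)$ has vertex set $A^{-\omega}/\rho$ and edges $(x\rho,a,(xa)\rho)$ for $x\in A^{-\omega}$, $a\in A$ (where $x\rho$ is the $\rho$-class of $x$). $\mathrm{Res}(\rho)$ is the set of all $w\in A^*$ such that all paths in $\mathrm{Cay}(\rho)$ labelled by $w$ end at the same vertex. A $\rho$-class $C$ is nonsingular if $|C|>1$; then $\mathrm{lcs}(C)$ is the longest common suffix of all words in $C$. $\Lambda_\rho=\{\mathrm{lcs}(C)\mid C\in A^{-\omega}/\rho\text{ nonsingular}\}$ and $\Lambda'_\rho=\{\mathrm{lcs}(x,y)\mid(x,y)\in\rho,\ x\ne y\}$. *)

theory Defs
  imports "HOL-Analysis.Analysis" "HOL-Algebra.Complete_Lattice"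
begin

text \<open>Throughout, the alphabet is the type \<open>'a\<close>, so \<open>A\<^sup>*\<close> is \<open>UNIV :: 'a list set\<close>.\<close>

section \<open>Left infinite words and the suffix metric\<close>

text \<open>The word \<open>\<dots> a\<^sub>3 a\<^sub>2 a\<^sub>1\<close> is encoded by its letters counted from the right end:
  \<open>letter x 0\<close> is the last letter of \<open>x\<close>.
  Finite words are lists, written left to right.\<close>

datatype 'a lword = LWord (letter: "nat \<Rightarrow> 'a")

definition lapp :: "'a lword \<Rightarrow> 'a list \<Rightarrow> 'a lword" (infixl "\<frown>" 65) where
  "x \<frown> u = LWord (\<lambda>i. if i < length u then rev u ! i else letter x (i - length u))"

text \<open>The set \<open>A\<^bsup>-\<omega>\<^esup>u\<close>.\<close>

definition ending_in :: "'a list \<Rightarrow> 'a lword set" where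
  "ending_in u = {x \<frown> u | x. True}"

text \<open>Longest common suffix of a set of words; meaningful only for sets with at least two
  elements, see \<open>lcs_nonsingular\<close> below.\<close>

definition lcs :: "'a lword set \<Rightarrow> 'a list" where
  "lcs C = (ARG_MAX length u. \<forall>x\<in>C. x \<in> ending_in u)"

lemma letter_lapp:
  "letter (x \<frown> u) i = (if i < length u then rev u ! i else letter x (i - length u))"
  by (simp add: lapp_def)

lemma lapp_Nil [simp]: "x \<frown> [] = x"
  by (simp add: lapp_def)

lemma lapp_append: "x \<frown> (u @ v) = x \<frown> u \<frown> v"
  by (rule lword.expand) (auto simp: fun_eq_iff letter_lapp nth_append diff_diff_left add.commute)

lemma mem_ending_in_iff: "x \<in> ending_in u \<longleftrightarrow> (\<forall>i<length u. letter x i = rev u ! i)"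
proof
  assume "\<forall>i<length u. letter x i = rev u ! i"
  then have "x = LWord (\<lambda>i. letter x (i + length u)) \<frown> u"
    by (intro lword.expand) (auto simp: lapp_def fun_eq_iff)
  then show "x \<in> ending_in u"
    unfolding ending_in_def by blast
qed (auto simp: ending_in_def letter_lapp)

lemma common_suffix_bound:
  assumes "letter x n \<noteq> letter y n" "x \<in> ending_in u" "y \<in> ending_in u"
  shows "length u \<le> n"
  using assms by (metis mem_ending_in_iff not_le)

lemma ending_in_inj:
  assumes "x \<in> ending_in u" "x \<in> ending_in v" "length u = length v"
  shows "u = v"
proof -
  have "rev u = rev v"
    using assms by (intro nth_equalityI) (auto simp: mem_ending_in_iff)
  then show ?thesis by simp
qed

lemma lcs_nonsingular:
  assumes "x \<in> C" "y \<in> C" "x \<noteq> y"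
  shows "(\<forall>z\<in>C. z \<in> ending_in u) \<and> (\<forall>v. (\<forall>z\<in>C. z \<in> ending_in v) \<longrightarrow> length v \<le> length u)
    \<longleftrightarrow> u = lcs C"
proof -
  let ?P = "\<lambda>u. \<forall>z\<in>C. z \<in> ending_in u"
  obtain n where n: "letter x n \<noteq> letter y n"
    using \<open>x \<noteq> y\<close> by (metis ext lword.expand)
  have "?P []" by (simp add: mem_ending_in_iff)
  moreover have "\<forall>v. ?P v \<longrightarrow> length v < Suc n"
    using common_suffix_bound[OF n] assms by (simp add: less_Suc_eq_le)
  ultimately have *: "?P (lcs C) \<and> (\<forall>v. ?P v \<longrightarrow> length v \<le> length (lcs C))"
    unfolding lcs_def using arg_max_nat_lemma[of ?P "[]" length "Suc n"] by blast
  show ?thesis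
  proof
    assume u: "?P u \<and> (\<forall>v. ?P v \<longrightarrow> length v \<le> length u)"
    with * have "length u = length (lcs C)" by (meson le_antisym)
    with u * show "u = lcs C" using ending_in_inj[of x u "lcs C"] \<open>x \<in> C\<close> by blast
  qed (use * in simp)
qed

lemma less_length_lcs_iff:
  assumes "x \<noteq> y"
  shows "n < length (lcs {x, y}) \<longleftrightarrow> (\<forall>i\<le>n. letter x i = letter y i)"
proof -
  have *: "x \<in> ending_in (lcs {x, y})" "y \<in> ending_in (lcs {x, y})"
    "\<And>v. \<lbrakk>x \<in> ending_in v; y \<in> ending_in v\<rbrakk> \<Longrightarrow> length v \<le> length (lcs {x, y})"
    using lcs_nonsingular[of x "{x, y}" y "lcs {x, y}"] assms by auto
  show ?thesis
  proof
    assume "n < length (lcs {x, y})"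
    with * show "\<forall>i\<le>n. letter x i = letter y i"
      by (auto simp: mem_ending_in_iff)
  next
    assume eq: "\<forall>i\<le>n. letter x i = letter y i"
    let ?v = "rev (map (letter x) [0..<Suc n])"
    have "length ?v \<le> length (lcs {x, y})"
      using eq by (intro *) (auto simp: mem_ending_in_iff simp del: upt_Suc)
    then show "n < length (lcs {x, y})" by simp
  qed
qed

instantiation lword :: (type) metric_space
begin

definition dist_lword_def:
  "dist (x :: 'a lword) y = (if x = y then 0 else 1 / 2 ^ length (lcs {x, y}))"

definition uniformity_lword_def:
  "uniformity = (INF e\<in>{0 <..}. principal {(x :: 'a lword, y). dist x y < e})"

definition open_lword_def:
  "open (U :: 'a lword set) \<longleftrightarrow> (\<forall>x\<in>U. eventually (\<lambda>(x', y). x' = x \<longrightarrow> y \<in> U) uniformity)"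

instance
proof
  fix x y z :: "'a lword"
  show "dist x y = 0 \<longleftrightarrow> x = y"
    by (simp add: dist_lword_def)
  show "dist x y \<le> dist x z + dist y z"
  proof (cases "x = y \<or> x = z \<or> y = z")
    case True
    then show ?thesis by (auto simp: dist_lword_def insert_commute)
  next
    case False
    have "min (length (lcs {x, z})) (length (lcs {y, z})) \<le> length (lcs {x, y})"
    proof (rule ccontr)
      assume "\<not> ?thesis"
      then have "length (lcs {x, y}) < length (lcs {x, z})" "length (lcs {x, y}) < length (lcs {y, z})"
        by auto
      then have "\<forall>i\<le>length (lcs {x, y}). letter x i = letter y i"
        using False less_length_lcs_iff[of x z "length (lcs {x, y})"]
          less_length_lcs_iff[of y z "length (lcs {x, y})"] by simp
      then show False
        using False less_length_lcs_iff[of x y "length (lcs {x, y})"] by simp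
    qed
    then consider "length (lcs {x, z}) \<le> length (lcs {x, y})"
      | "length (lcs {y, z}) \<le> length (lcs {x, y})" by linarith
    then show ?thesis
    proof cases
      case 1
      then have "1 / 2 ^ length (lcs {x, y}) \<le> (1 / 2 ^ length (lcs {x, z}) :: real)"
        by (simp add: frac_le power_increasing)
      with False show ?thesis by (simp add: dist_lword_def add_increasing2)
    next
      case 2
      then have "1 / 2 ^ length (lcs {x, y}) \<le> (1 / 2 ^ length (lcs {y, z}) :: real)"
        by (simp add: frac_le power_increasing)
      with False show ?thesis by (simp add: dist_lword_def add_increasing)
    qed
  qed
qed (rule uniformity_lword_def open_lword_def)+

end

text \<open>The library metric on products is the Euclidean one; it has the same closed sets as the
  max metric.\<close>

lemma closed_prod_max_dist:
  fixes R :: "('b::metric_space \<times> 'c::metric_space) set"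
  shows "closed R \<longleftrightarrow>
    (\<forall>x y. (\<forall>e>0. \<exists>(x', y')\<in>R. max (dist x' x) (dist y' y) < e) \<longrightarrow> (x, y) \<in> R)"
proof -
  have "(x, y) \<in> closure R \<longleftrightarrow> (\<forall>e>0. \<exists>(x', y')\<in>R. max (dist x' x) (dist y' y) < e)" for x y
  proof
    assume cl: "(x, y) \<in> closure R"
    show "\<forall>e>0. \<exists>(x', y')\<in>R. max (dist x' x) (dist y' y) < e"
    proof (intro allI impI)
      fix e :: real assume "e > 0"
      with cl obtain p where p: "p \<in> R" "dist p (x, y) < e"
        by (auto simp: closure_approachable)
      then show "\<exists>(x', y')\<in>R. max (dist x' x) (dist y' y) < e"
        using dist_fst_le[of p "(x, y)"] dist_snd_le[of p "(x, y)"]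
        by (intro bexI[of _ p]) auto
    qed
  next
    assume *: "\<forall>e>0. \<exists>(x', y')\<in>R. max (dist x' x) (dist y' y) < e"
    show "(x, y) \<in> closure R"
      unfolding closure_approachable
    proof (intro allI impI)
      fix e :: real assume "e > 0"
      with * obtain x' y' where p: "(x', y') \<in> R" "max (dist x' x) (dist y' y) < e / 2"
        by (metis (no_types, lifting) case_prodE half_gt_zero)
      have "dist (x', y') (x, y) \<le> dist x' x + dist y' y"
        by (simp add: dist_Pair_Pair sqrt_sum_squares_le_sum)
      with p show "\<exists>p\<in>R. dist p (x, y) < e"
        by (intro bexI[of _ "(x', y')"]) auto
    qed
  qed
  then show ?thesis
    by (metis closure_closed closure_subset_eq subrelI)
qed

section \<open>Right congruences\<close>

definition RC :: "'a lword rel set" where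
  "RC = {\<rho>. equiv UNIV \<rho> \<and> (\<forall>x y u. (x, y) \<in> \<rho> \<longrightarrow> (x \<frown> u, y \<frown> u) \<in> \<rho>)}"

definition CRC :: "'a lword rel set" where
  "CRC = {\<rho> \<in> RC. closed \<rho>}"

definition RC_lattice :: "'a lword rel gorder" where
  "RC_lattice = \<lparr>carrier = RC, eq = (=), le = (\<subseteq>)\<rparr>"

lemma RC_UNIV: "UNIV \<in> RC"
  by (auto simp: RC_def intro!: equivI refl_onI symI transI)

lemma RC_Inter:
  assumes "S \<subseteq> RC"
  shows "\<Inter>S \<in> RC"
proof -
  have eq: "equiv UNIV X" if "X \<in> S" for X
    using assms that by (auto simp: RC_def)
  have "equiv UNIV (\<Inter>S)"
  proof (rule equivI)
    show "refl_on UNIV (\<Inter>S)"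
      using eq by (auto simp: equiv_def intro!: refl_onI dest: refl_onD)
    show "sym (\<Inter>S)"
      using eq by (intro symI InterI) (meson InterD equivE symD)
    show "trans (\<Inter>S)"
      using eq by (intro transI InterI) (meson InterD equivE transD)
  qed simp
  moreover have "(x \<frown> u, y \<frown> u) \<in> \<Inter>S" if "(x, y) \<in> \<Inter>S" for x y u
    using assms that by (auto simp: RC_def)
  ultimately show ?thesis by (simp add: RC_def)
qed

lemma complete_lattice_RC: "complete_lattice (RC_lattice :: 'a lword rel gorder)"
proof -
  interpret partial_order "RC_lattice :: 'a lword rel gorder"
    by unfold_locales (auto simp: RC_lattice_def)
  show ?thesis
  proof (rule complete_lattice_criterion1)
    show "\<exists>g. greatest RC_lattice g (carrier (RC_lattice :: 'a lword rel gorder))"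
      by (rule exI[of _ UNIV]) (auto simp: RC_lattice_def greatest_def RC_UNIV)
    fix S :: "'a lword rel set"
    assume "S \<subseteq> carrier RC_lattice" "S \<noteq> {}"
    then show "\<exists>i. greatest RC_lattice i (Lower RC_lattice S)"
      by (intro exI[of _ "\<Inter>S"]) (auto simp: RC_lattice_def greatest_def Lower_def RC_Inter)
  qed
qed

section \<open>Special right congruences\<close>

definition conc :: "'a list set \<Rightarrow> 'a list set \<Rightarrow> 'a list set" (infixr "@@" 75) where
  "X @@ Y = {u @ v | u v. u \<in> X \<and> v \<in> Y}"

definition is_ideal :: "'a list set \<Rightarrow> bool" where
  "is_ideal I \<longleftrightarrow> UNIV @@ I @@ UNIV \<subseteq> I"

definition tau :: "'a list set \<Rightarrow> 'a lword rel" where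
  "tau P = {(x, y). x = y \<or> (\<exists>u\<in>P. x \<in> ending_in u \<and> y \<in> ending_in u)}"

definition SRC :: "'a lword rel set" where
  "SRC = {\<rho> \<in> RC. \<exists>I. is_ideal I \<and> \<rho> = tau I}"

definition src_lower :: "'a lword rel \<Rightarrow> 'a lword rel" where
  "src_lower \<rho> = \<Squnion>\<^bsub>RC_lattice\<^esub> {\<tau> \<in> SRC. \<tau> \<subseteq> \<rho>}"

definition src_upper :: "'a lword rel \<Rightarrow> 'a lword rel" where
  "src_upper \<rho> = \<Sqinter>\<^bsub>RC_lattice\<^esub> {\<tau> \<in> SRC. \<rho> \<subseteq> \<tau>}"

section \<open>The Cayley graph and its resets\<close>

definition cay_verts :: "'a lword rel \<Rightarrow> 'a lword set set" where
  "cay_verts \<rho> = UNIV // \<rho>"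

definition cay_edges :: "'a lword rel \<Rightarrow> ('a lword set \<times> 'a \<times> 'a lword set) set" where
  "cay_edges \<rho> = {(\<rho> `` {x}, a, \<rho> `` {x \<frown> [a]}) | x a. True}"

text \<open>\<open>cay_path \<rho> p w q\<close>: there is a path from \<open>p\<close> to \<open>q\<close> labelled by \<open>w\<close>.\<close>

inductive cay_path :: "'a lword rel \<Rightarrow> 'a lword set \<Rightarrow> 'a list \<Rightarrow> 'a lword set \<Rightarrow> bool"
  for \<rho> where
  Nil: "p \<in> cay_verts \<rho> \<Longrightarrow> cay_path \<rho> p [] p"
| Cons: "(p, a, q) \<in> cay_edges \<rho> \<Longrightarrow> cay_path \<rho> q w r \<Longrightarrow> cay_path \<rho> p (a # w) r"

definition Res :: "'a lword rel \<Rightarrow> 'a list set" where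
  "Res \<rho> = {w. \<forall>p q p' q'. cay_path \<rho> p w q \<and> cay_path \<rho> p' w q' \<longrightarrow> q = q'}"

section \<open>Longest common suffixes of classes and of pairs\<close>

text \<open>Stated without \<open>card\<close>, which is \<open>0\<close> on infinite classes.\<close>

definition nonsingular :: "'a lword set \<Rightarrow> bool" where
  "nonsingular C \<longleftrightarrow> (\<exists>x\<in>C. \<exists>y\<in>C. x \<noteq> y)"

definition Lambda :: "'a lword rel \<Rightarrow> 'a list set" where
  "Lambda \<rho> = {lcs C | C. C \<in> UNIV // \<rho> \<and> nonsingular C}"

definition Lambda' :: "'a lword rel \<Rightarrow> 'a list set" where
  "Lambda' \<rho> = {lcs {x, y} | x y. (x, y) \<in> \<rho> \<and> x \<noteq> y}"

end

theory Submission
  imports Defs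
begin

text \<open>Both bounds are attained inside the special right congruences. A word \<open>w\<close> is a reset iff
  \<open>xw \<rho> yw\<close> for all \<open>x, y\<close>, so \<open>Res \<rho>\<close> is the largest ideal whose special right congruence lies
  below \<open>\<rho>\<close>. Dually, an ideal has its special right congruence above \<open>\<rho>\<close> iff it contains the longest
  common suffix of every nontrivial pair in \<open>\<rho>\<close>; these suffixes are stable under right multiplication,
  so \<open>A\<^sup>*\<Lambda>'\<close> is the smallest such ideal. Finally \<open>\<Lambda> \<subseteq> \<Lambda>' \<subseteq> A\<^sup>*\<Lambda>\<close>, as the longest common suffix of a
  class is already that of two of its members.\<close>

section \<open>Right congruences and their lattice\<close>

lemma RC_lapp: "\<lbrakk>\<rho> \<in> RC; (x, y) \<in> \<rho>\<rbrakk> \<Longrightarrow> (x \<frown> u, y \<frown> u) \<in> \<rho>"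
  by (simp add: RC_def)

text \<open>A greatest member of \<open>S\<close> is its least upper bound, so joins in
  \<open>RC\<close>, which are not plain unions in general, need never be computed.\<close>

lemma RC_lattice_sup_eq:
  assumes "\<sigma> \<in> S" "S \<subseteq> RC" "\<And>\<tau>. \<tau> \<in> S \<Longrightarrow> \<tau> \<subseteq> \<sigma>"
  shows "\<Squnion>\<^bsub>RC_lattice\<^esub> S = \<sigma>"
proof -
  have "\<sigma> \<in> Upper RC_lattice S" "\<forall>x\<in>Upper RC_lattice S. \<sigma> \<subseteq> x"
    using assms by (auto simp: Upper_def RC_lattice_def)
  \<comment> \<open>The join is defined by choice among least upper bounds, so
    \<open>\<sigma>\<close> must be shown to be the only one.\<close>
  then have "least RC_lattice x (Upper RC_lattice S) \<longleftrightarrow> x = \<sigma>" for x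
    by (auto simp: least_def RC_lattice_def Upper_def)
  then show ?thesis by (simp add: sup_def)
qed

lemma RC_lattice_inf_eq:
  assumes "\<sigma> \<in> S" "S \<subseteq> RC" "\<And>\<tau>. \<tau> \<in> S \<Longrightarrow> \<sigma> \<subseteq> \<tau>"
  shows "\<Sqinter>\<^bsub>RC_lattice\<^esub> S = \<sigma>"
proof -
  have "\<sigma> \<in> Lower RC_lattice S" "\<forall>x\<in>Lower RC_lattice S. x \<subseteq> \<sigma>"
    using assms by (auto simp: Lower_def RC_lattice_def)
  then have "greatest RC_lattice x (Lower RC_lattice S) \<longleftrightarrow> x = \<sigma>" for x
    by (auto simp: greatest_def RC_lattice_def Lower_def)
  then show ?thesis by (simp add: inf_def)
qed

section \<open>Suffixes of left infinite words\<close>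

lemma lapp_mem_ending_in: "x \<frown> u \<in> ending_in u"
  by (auto simp: ending_in_def)

lemma ending_in_lapp: "x \<in> ending_in u \<Longrightarrow> x \<frown> v \<in> ending_in (u @ v)"
  by (auto simp: ending_in_def lapp_append)

lemma ending_in_appendD: "x \<in> ending_in (v @ u) \<Longrightarrow> x \<in> ending_in u"
  by (auto simp: ending_in_def lapp_append)

text \<open>The suffixes of one word form a chain: \<open>u\<close> agrees with the final segment of
  \<open>v\<close> of the same length.\<close>

lemma ending_in_comparable:
  assumes "x \<in> ending_in u" "x \<in> ending_in v" "length u \<le> length v"
  obtains w where "v = w @ u"
proof -
  let ?k = "length v - length u"
  have "x \<in> ending_in (drop ?k v)"
    using assms(2) ending_in_appendD[of x "take ?k v"] by simp
  then have "drop ?k v = u"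
    using assms by (intro ending_in_inj[of x]) auto
  then show thesis
    using that[of "take ?k v"] by (metis append_take_drop_id)
qed

section \<open>Special right congruences of ideals\<close>

lemma is_ideal_append: "\<lbrakk>is_ideal I; u \<in> I\<rbrakk> \<Longrightarrow> v @ u @ w \<in> I"
  unfolding is_ideal_def conc_def by blast

lemma tau_mono: "P \<subseteq> Q \<Longrightarrow> tau P \<subseteq> tau Q"
  by (auto simp: tau_def)

lemma tau_ideal_RC:
  assumes "is_ideal I"
  shows "tau I \<in> RC"
proof -
  have "trans (tau I)"
  proof (rule transI)
    fix x y z
    assume "(x, y) \<in> tau I" "(y, z) \<in> tau I"
    then consider "x = y" "(y, z) \<in> tau I" | "y = z" "(x, y) \<in> tau I"
      | u v where "u \<in> I" "v \<in> I" "x \<in> ending_in u" "y \<in> ending_in u"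
          "y \<in> ending_in v" "z \<in> ending_in v"
      unfolding tau_def by blast
    then show "(x, z) \<in> tau I"
    proof cases
      case 3
      \<comment> \<open>Of two suffixes of \<open>y\<close>, the shorter one is a suffix of the longer one.\<close>
      then have "(z \<in> ending_in u) \<or> (x \<in> ending_in v)"
        by (metis ending_in_comparable ending_in_appendD nat_le_linear)
      with 3 show ?thesis unfolding tau_def by blast
    qed auto
  qed
  then have "equiv UNIV (tau I)"
    by (intro equivI refl_onI symI) (auto simp: tau_def)
  \<comment> \<open>A common suffix in \<open>I\<close> is extended by \<open>u\<close> and stays in
    the ideal.\<close>
  moreover have "(x \<frown> u, y \<frown> u) \<in> tau I" if "(x, y) \<in> tau I" for x y u
    using that is_ideal_append[OF assms, of _ "[]" u] by (auto simp: tau_def intro: ending_in_lapp)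
  ultimately show ?thesis by (simp add: RC_def)
qed

lemma tau_ideal_SRC: "is_ideal I \<Longrightarrow> tau I \<in> SRC"
  using tau_ideal_RC by (auto simp: SRC_def)

section \<open>Paths in the Cayley graph and resets\<close>

lemma cay_path_iff:
  assumes "\<rho> \<in> RC"
  shows "cay_path \<rho> p w q \<longleftrightarrow> (\<exists>x. p = \<rho> `` {x} \<and> q = \<rho> `` {x \<frown> w})"
proof
  have eq: "equiv UNIV \<rho>" using assms by (simp add: RC_def)
  show "\<exists>x. p = \<rho> `` {x} \<and> q = \<rho> `` {x \<frown> w}" if "cay_path \<rho> p w q"
    using that
  proof induction
    case (Nil p)
    then show ?case by (auto simp: cay_verts_def quotient_def)
  next
    case (Cons p a q w r)
    then obtain x y where x: "p = \<rho> `` {x}" "q = \<rho> `` {x \<frown> [a]}"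
      and y: "q = \<rho> `` {y}" "r = \<rho> `` {y \<frown> w}"
      by (auto simp: cay_edges_def)
    then have "(x \<frown> [a], y) \<in> \<rho>"
      using eq_equiv_class[OF _ eq] by simp
    \<comment> \<open>The edge and the remaining path may use different representatives of
      \<open>q\<close>; right compatibility lets the path be followed from
      \<open>x \<frown> [a]\<close> instead of \<open>y\<close>.\<close>
    then have "\<rho> `` {x \<frown> [a] \<frown> w} = r"
      using y equiv_class_eq[OF eq] RC_lapp[OF assms] by blast
    with x show ?case by (metis append_Cons append_Nil lapp_append)
  qed
next
  assume "\<exists>x. p = \<rho> `` {x} \<and> q = \<rho> `` {x \<frown> w}"
  then obtain x where "p = \<rho> `` {x}" "q = \<rho> `` {x \<frown> w}" by blast
  moreover have "cay_path \<rho> (\<rho> `` {x}) w (\<rho> `` {x \<frown> w})"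
  proof (induction w arbitrary: x)
    case Nil
    have "\<rho> `` {x} \<in> cay_verts \<rho>" by (auto simp: cay_verts_def quotient_def)
    then show ?case by (simp add: cay_path.Nil)
  next
    case (Cons a w)
    have "(\<rho> `` {x}, a, \<rho> `` {x \<frown> [a]}) \<in> cay_edges \<rho>"
      by (auto simp: cay_edges_def)
    then show ?case
      using Cons[of "x \<frown> [a]"] by (auto simp flip: lapp_append intro: cay_path.Cons)
  qed
  ultimately show "cay_path \<rho> p w q" by simp
qed

lemma mem_Res_iff:
  assumes "\<rho> \<in> RC"
  shows "w \<in> Res \<rho> \<longleftrightarrow> (\<forall>x y. (x \<frown> w, y \<frown> w) \<in> \<rho>)"
proof -
  have "equiv UNIV \<rho>" using assms by (simp add: RC_def)
  then have "\<rho> `` {x} = \<rho> `` {y} \<longleftrightarrow> (x, y) \<in> \<rho>" for x y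
    by (simp add: eq_equiv_class_iff)
  then show ?thesis
    unfolding Res_def cay_path_iff[OF assms] by blast
qed

text \<open>A left factor is absorbed into the arbitrary words \<open>x\<close>, \<open>y\<close>; a
  right factor is handled by right compatibility.\<close>

lemma Res_ideal:
  assumes "\<rho> \<in> RC"
  shows "is_ideal (Res \<rho>)"
  using RC_lapp[OF assms]
  by (auto simp: is_ideal_def conc_def mem_Res_iff[OF assms] lapp_append)

text \<open>The pairs that \<open>tau I\<close> adds to equality are exactly those of the form
  \<open>(x \<frown> u, y \<frown> u)\<close> with \<open>u\<close> in \<open>I\<close>.\<close>

lemma tau_subset_iff:
  assumes "\<rho> \<in> RC"
  shows "tau I \<subseteq> \<rho> \<longleftrightarrow> I \<subseteq> Res \<rho>"
proof
  assume "tau I \<subseteq> \<rho>"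
  then show "I \<subseteq> Res \<rho>"
    unfolding mem_Res_iff[OF assms] subset_iff
    by (auto simp: tau_def intro: lapp_mem_ending_in)
next
  have "refl \<rho>" using assms by (simp add: RC_def equiv_def)
  moreover assume "I \<subseteq> Res \<rho>"
  ultimately show "tau I \<subseteq> \<rho>"
    by (auto simp: tau_def ending_in_def mem_Res_iff[OF assms] subset_iff dest: refl_onD)
qed

lemma src_lower_eq:
  assumes "\<rho> \<in> RC"
  shows "src_lower \<rho> = tau (Res \<rho>)"
  unfolding src_lower_def
proof (rule RC_lattice_sup_eq)
  show "tau (Res \<rho>) \<in> {\<tau> \<in> SRC. \<tau> \<subseteq> \<rho>}"
    using assms by (simp add: tau_ideal_SRC Res_ideal tau_subset_iff)
  show "\<tau> \<subseteq> tau (Res \<rho>)" if \<tau>: "\<tau> \<in> {\<tau> \<in> SRC. \<tau> \<subseteq> \<rho>}" for \<tau>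
  proof -
    obtain I where "\<tau> = tau I"
      using \<tau> unfolding SRC_def by blast
    with \<tau> show ?thesis
      by (simp add: tau_mono tau_subset_iff[OF assms])
  qed
qed (auto simp: SRC_def)

section \<open>Longest common suffixes of classes and of pairs\<close>

lemma lcs_suffix:
  assumes "nonsingular C" "x \<in> C"
  shows "x \<in> ending_in (lcs C)"
  using assms lcs_nonsingular unfolding nonsingular_def by metis

lemma lcs_maximal:
  assumes "nonsingular C" "\<And>x. x \<in> C \<Longrightarrow> x \<in> ending_in v"
  obtains w where "lcs C = w @ v"
proof -
  obtain x y where xy: "x \<in> C" "y \<in> C" "x \<noteq> y"
    using assms(1) by (auto simp: nonsingular_def)
  then have "length v \<le> length (lcs C)"
    using assms(2) lcs_nonsingular by metis
  then show thesis
    using that ending_in_comparable assms(2) lcs_suffix[OF assms(1)] xy(1) by metis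
qed

text \<open>Letters are counted from the right starting at 0, so index \<open>length u\<close> is
  the letter just to the left of the suffix \<open>u\<close>.\<close>

lemma lcs_pair_eqI:
  assumes "x \<in> ending_in u" "y \<in> ending_in u" "letter x (length u) \<noteq> letter y (length u)"
  shows "lcs {x, y} = u"
  using lcs_nonsingular[of x "{x, y}" y u] assms common_suffix_bound[OF assms(3)] by auto

lemma lcs_pair_letter:
  assumes "x \<noteq> y"
  shows "letter x (length (lcs {x, y})) \<noteq> letter y (length (lcs {x, y}))"
proof -
  let ?n = "length (lcs {x, y})"
  have "letter x i = letter y i" if "i < ?n" for i
    using less_length_lcs_iff[OF assms] that by blast
  then show ?thesis
    using less_length_lcs_iff[OF assms, of ?n] by (metis le_neq_implies_less less_irrefl)
qed

lemma pair_suffix: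
  assumes "x \<noteq> y"
  shows "x \<in> ending_in (lcs {x, y})" "y \<in> ending_in (lcs {x, y})"
  using assms lcs_suffix[of "{x, y}"] by (auto simp: nonsingular_def)

text \<open>Appending \<open>v\<close> shifts the first mismatch from the right by
  \<open>length v\<close>.\<close>

lemma lcs_pair_lapp:
  assumes "x \<noteq> y"
  shows "lcs {x \<frown> v, y \<frown> v} = lcs {x, y} @ v"
  using lcs_pair_letter[OF assms] pair_suffix[OF assms]
  by (intro lcs_pair_eqI ending_in_lapp) (auto simp: letter_lapp)

lemma lcs_eq_lcs_pair:
  assumes "nonsingular C"
  obtains x y where "x \<in> C" "y \<in> C" "x \<noteq> y" "lcs {x, y} = lcs C"
proof -
  obtain x where x: "x \<in> C" using assms by (auto simp: nonsingular_def)
  let ?u = "lcs C" let ?n = "length (lcs C)"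
  \<comment> \<open>Any \<open>x\<close> in \<open>C\<close> will do: if all of \<open>C\<close>
    shared its letter at \<open>?n\<close>, the common suffix could be lengthened by that
    letter.\<close>
  have "\<exists>y\<in>C. letter x ?n \<noteq> letter y ?n"
  proof (rule ccontr)
    assume "\<not> ?thesis"
    then have "z \<in> ending_in (letter x ?n # ?u)" if "z \<in> C" for z
      using that lcs_suffix[OF assms that]
      by (auto simp: mem_ending_in_iff nth_append less_Suc_eq)
    then obtain w where "?u = w @ letter x ?n # ?u"
      by (rule lcs_maximal[OF assms])
    then have "?n = length (w @ letter x ?n # ?u)" by metis
    then show False by simp
  qed
  then obtain y where y: "y \<in> C" "letter x ?n \<noteq> letter y ?n" by blast
  then have "lcs {x, y} = ?u"
    using x lcs_suffix[OF assms] by (intro lcs_pair_eqI) auto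
  with x y that show thesis by blast
qed

section \<open>Ideals generated by longest common suffixes\<close>

lemma conc_mono: "X \<subseteq> Y \<Longrightarrow> Z @@ X \<subseteq> Z @@ Y"
  by (auto simp: conc_def)

lemma left_ideal_minimal:
  assumes "X \<subseteq> UNIV @@ Y"
  shows "UNIV @@ X \<subseteq> UNIV @@ Y"
proof
  fix w assume "w \<in> UNIV @@ X"
  then obtain a b u where "w = (a @ b) @ u" "u \<in> Y"
    using assms unfolding conc_def by (auto simp: subset_iff simp flip: append_assoc)
  then show "w \<in> UNIV @@ Y" unfolding conc_def by blast
qed

lemma left_ideal_Lambda:
  assumes "\<rho> \<in> RC"
  shows "UNIV @@ Lambda \<rho> = UNIV @@ Lambda' \<rho>"
proof -
  have eq: "equiv UNIV \<rho>" using assms by (simp add: RC_def)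
  have "Lambda \<rho> \<subseteq> Lambda' \<rho>"
  proof
    fix u assume "u \<in> Lambda \<rho>"
    then obtain C where C: "C \<in> UNIV // \<rho>" "nonsingular C" "u = lcs C"
      by (auto simp: Lambda_def)
    from C(2) obtain x y where xy: "x \<in> C" "y \<in> C" "x \<noteq> y" "lcs {x, y} = lcs C"
      by (rule lcs_eq_lcs_pair)
    with C(1) have "(x, y) \<in> \<rho>"
      using in_quotient_imp_in_rel[OF eq] by blast
    with xy C(3) show "u \<in> Lambda' \<rho>" unfolding Lambda'_def by (metis (mono_tags, lifting) mem_Collect_eq)
  qed
  moreover have "Lambda' \<rho> \<subseteq> UNIV @@ Lambda \<rho>"
  proof
    fix u assume "u \<in> Lambda' \<rho>"
    then obtain x y where xy: "(x, y) \<in> \<rho>" "x \<noteq> y" "u = lcs {x, y}"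
      by (auto simp: Lambda'_def)
    let ?C = "\<rho> `` {x}"
    have C: "x \<in> ?C" "y \<in> ?C"
      using xy(1) equiv_class_self[OF eq] by auto
    with xy(2) have ns: "nonsingular ?C" by (auto simp: nonsingular_def)
    \<comment> \<open>The common suffix of the whole class is shared by the pair, hence is a suffix
      of \<open>lcs {x, y}\<close>.\<close>
    obtain w where "u = w @ lcs ?C"
      using lcs_maximal[of "{x, y}" "lcs ?C"] lcs_suffix[OF ns] C xy
      by (auto simp: nonsingular_def)
    moreover have "lcs ?C \<in> Lambda \<rho>"
      using ns by (auto simp: Lambda_def quotient_def)
    ultimately show "u \<in> UNIV @@ Lambda \<rho>" by (auto simp: conc_def)
  qed
  ultimately show ?thesis
    using left_ideal_minimal conc_mono by (metis subset_antisym)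
qed

lemma Lambda'_append:
  assumes "\<rho> \<in> RC" "u \<in> Lambda' \<rho>"
  shows "u @ v \<in> Lambda' \<rho>"
proof -
  obtain x y where xy: "(x, y) \<in> \<rho>" "x \<noteq> y" "u = lcs {x, y}"
    using assms(2) by (auto simp: Lambda'_def)
  \<comment> \<open>Distinctness survives because the mismatch moves to index
    \<open>length (lcs {x, y}) + length v\<close>.\<close>
  have "x \<frown> v \<noteq> y \<frown> v"
    using lcs_pair_letter[OF xy(2)]
    by (metis add_diff_cancel_right' letter_lapp not_add_less2)
  with xy RC_lapp[OF assms(1)] lcs_pair_lapp[OF xy(2), of v] show ?thesis
    unfolding Lambda'_def by (smt (verit) mem_Collect_eq)
qed

lemma left_ideal_Lambda'_ideal:
  assumes "\<rho> \<in> RC"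
  shows "is_ideal (UNIV @@ Lambda' \<rho>)"
  unfolding is_ideal_def
proof
  fix w assume "w \<in> UNIV @@ (UNIV @@ Lambda' \<rho>) @@ UNIV"
  then obtain a b u c where "w = a @ (b @ u) @ c" "u \<in> Lambda' \<rho>"
    unfolding conc_def by blast
  then have "w = (a @ b) @ (u @ c)" "u @ c \<in> Lambda' \<rho>"
    using Lambda'_append[OF assms] by simp_all
  then show "w \<in> UNIV @@ Lambda' \<rho>"
    unfolding conc_def by blast
qed

text \<open>Any suffix in \<open>I\<close> witnessing a nontrivial pair is a suffix of its longest
  common suffix, which the ideal therefore contains; conversely the longest common suffix is itself
  a witness.\<close>

lemma subset_tau_iff:
  assumes "is_ideal I"
  shows "\<rho> \<subseteq> tau I \<longleftrightarrow> Lambda' \<rho> \<subseteq> I"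
proof
  assume sub: "\<rho> \<subseteq> tau I"
  show "Lambda' \<rho> \<subseteq> I"
  proof
    fix u assume "u \<in> Lambda' \<rho>"
    then obtain x y where xy: "(x, y) \<in> \<rho>" "x \<noteq> y" "u = lcs {x, y}"
      by (auto simp: Lambda'_def)
    with sub obtain v where v: "v \<in> I" "x \<in> ending_in v" "y \<in> ending_in v"
      by (auto simp: tau_def)
    then obtain w where "u = w @ v"
      using lcs_maximal[of "{x, y}" v] xy by (auto simp: nonsingular_def)
    with v show "u \<in> I" using is_ideal_append[OF assms, of v w "[]"] by simp
  qed
next
  assume "Lambda' \<rho> \<subseteq> I"
  then show "\<rho> \<subseteq> tau I"
    using pair_suffix by (fastforce simp: tau_def Lambda'_def)
qed

lemma src_upper_eq:
  assumes "\<rho> \<in> RC"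
  shows "src_upper \<rho> = tau (UNIV @@ Lambda' \<rho>)"
  unfolding src_upper_def
proof (rule RC_lattice_inf_eq)
  have "Lambda' \<rho> \<subseteq> UNIV @@ Lambda' \<rho>"
    by (force simp: conc_def)
  then show "tau (UNIV @@ Lambda' \<rho>) \<in> {\<tau> \<in> SRC. \<rho> \<subseteq> \<tau>}"
    using left_ideal_Lambda'_ideal[OF assms] by (simp add: tau_ideal_SRC subset_tau_iff)
  show "tau (UNIV @@ Lambda' \<rho>) \<subseteq> \<tau>" if \<tau>: "\<tau> \<in> {\<tau> \<in> SRC. \<rho> \<subseteq> \<tau>}" for \<tau>
  proof -
    obtain I where I: "is_ideal I" "\<tau> = tau I"
      using \<tau> unfolding SRC_def by blast
    with \<tau> have "Lambda' \<rho> \<subseteq> I"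
      by (simp add: subset_tau_iff)
    then have "UNIV @@ Lambda' \<rho> \<subseteq> I"
      using is_ideal_append[OF I(1), of _ _ "[]"] by (auto simp: conc_def)
    with I(2) show ?thesis by (simp add: tau_mono)
  qed
qed (auto simp: SRC_def)

theorem proposition6p12:
  fixes \<rho> :: "'a::finite lword rel"
  assumes "CARD('a) > 1"
    and "\<rho> \<in> CRC"
  shows "src_lower \<rho> = tau (Res \<rho>)
    \<and> src_upper \<rho> = tau (UNIV @@ Lambda \<rho>)
    \<and> src_upper \<rho> = tau (UNIV @@ Lambda' \<rho>)"
proof -
  have "\<rho> \<in> RC" using assms(2) by (simp add: CRC_def)
  then show ?thesis
    by (simp add: src_lower_eq src_upper_eq left_ideal_Lambda)
qed

end
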